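(* Let $N \ge 2$ be an integer and let $1 < p < \infty$, $1 \le q < \infty$, $1 < b < 1 + Nq$. If $(u_j)$ is a bounded sequence in $L^{p,q}_b(\mathbb{R}^N)$ such that $u_j \to u$ in $L^p_{\mathrm{loc}}(\mathbb{R}^N)$, then $u \in L^{p,q}_b(\mathbb{R}^N)$ and $$\|u_j\|_{L^{p,q}_b(\mathbb{R}^N)}^{pq} - \|u_j - u\|_{L^{p,q}_b(\mathbb{R}^N)}^{pq} \to \|u\|_{L^{p,q}_b(\mathbb{R}^N)}^{pq} \quad \text{as } j \to \infty.$$
   Context: $B_\rho = \{x \in \mathbb{R}^N : |x| < \rho\}$. For a measurable function $u : \mathbb{R}^N \to \mathbb{R}$, $h_u(\rho) = \int_{B_\rho} |u|^p\, dy$ for $\rho > 0$. $L^{p,q}_b(\mathbb{R}^N)$ is the space of all measurable functions $u : \mathbb{R}^N \to \mathbb{R}$ (identified when equal a.e.) such that $\int_0^\infty \rho^{-b}\, h_u^q(\rho)\, d\rho < \infty$, with norm $\|u\|_{L^{p,q}_b(\mathbb{R}^N)} = \left(\int_0^\infty \rho^{-b}\, h_u^q(\rho)\, d\rho\right)^{1/pq}$. *)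

theory Defs
  imports "HOL-Analysis.Analysis"
begin

text \<open>Real powers on \<open>[0,\<infinity>]\<close> for a positive exponent, so that \<open>\<infinity>\<close> is sent to \<open>\<infinity>\<close>.\<close>

definition ennreal_powr :: "ennreal \<Rightarrow> real \<Rightarrow> ennreal" where
  "ennreal_powr x a = (if x = \<infinity> then \<infinity> else ennreal (enn2real x powr a))"

definition local_mass :: "real \<Rightarrow> (real ^ 'n \<Rightarrow> real) \<Rightarrow> real \<Rightarrow> ennreal" where
  "local_mass p u \<rho> = (\<integral>\<^sup>+ y \<in> ball 0 \<rho>. ennreal (\<bar>u y\<bar> powr p) \<partial>lebesgue)"

text \<open>The integral \<open>\<integral>\<^sub>0\<^sup>\<infinity> \<rho>\<^sup>-\<^sup>b h\<^sub>u(\<rho>)\<^sup>q d\<rho>\<close>, which may be infinite.\<close>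

definition Lpq_integral :: "real \<Rightarrow> real \<Rightarrow> real \<Rightarrow> (real ^ 'n \<Rightarrow> real) \<Rightarrow> ennreal" where
  "Lpq_integral p q b u =
     (\<integral>\<^sup>+ \<rho> \<in> {0<..}. ennreal (\<rho> powr (- b)) * ennreal_powr (local_mass p u \<rho>) q \<partial>lborel)"

text \<open>Elements of the function spaces are represented by functions rather than by
  classes modulo equality almost everywhere; all notions below are invariant under
  changing a function on a Lebesgue null set.\<close>

definition Lpq_space :: "real \<Rightarrow> real \<Rightarrow> real \<Rightarrow> (real ^ 'n \<Rightarrow> real) set" where
  "Lpq_space p q b = {u. u \<in> borel_measurable lebesgue \<and> Lpq_integral p q b u < \<infinity>}"

text \<open>Only meaningful on \<open>Lpq_space p q b\<close>: the conversion \<open>enn2real\<close> sends \<open>\<infinity>\<close> to \<open>0\<close>.\<close>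

definition Lpq_norm :: "real \<Rightarrow> real \<Rightarrow> real \<Rightarrow> (real ^ 'n \<Rightarrow> real) \<Rightarrow> real" where
  "Lpq_norm p q b u = enn2real (Lpq_integral p q b u) powr (1 / (p * q))"

definition Lp_loc :: "real \<Rightarrow> (real ^ 'n \<Rightarrow> real) set" where
  "Lp_loc p = {u. u \<in> borel_measurable lebesgue \<and>
     (\<forall>K. compact K \<longrightarrow> (\<integral>\<^sup>+ y \<in> K. ennreal (\<bar>u y\<bar> powr p) \<partial>lebesgue) < \<infinity>)}"

definition tendsto_Lp_loc ::
    "real \<Rightarrow> (nat \<Rightarrow> real ^ 'n \<Rightarrow> real) \<Rightarrow> (real ^ 'n \<Rightarrow> real) \<Rightarrow> bool" where
  "tendsto_Lp_loc p u v \<longleftrightarrow> (\<forall>j. u j \<in> Lp_loc p) \<and> v \<in> Lp_loc p \<and>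
     (\<forall>K. compact K \<longrightarrow>
        (\<lambda>j. \<integral>\<^sup>+ y \<in> K. ennreal (\<bar>u j y - v y\<bar> powr p) \<partial>lebesgue) \<longlonglongrightarrow> 0)"

end

theory Submission
  imports Defs
begin

text \<open>
  The theorem is the Brezis--Lieb argument applied to functions of the radius. For a function
  \<open>f\<close> consider \<open>m\<^sub>f(\<rho>) = \<rho>\<^sup>-\<^sup>b h\<^sub>f(\<rho>)\<^sup>q\<close> on \<open>(0,\<infinity>)\<close>, whose integral is the \<open>pq\<close>-th power of the
  norm of \<open>f\<close>; this is \<open>weighted_mass\<close> below. Since \<open>h\<^sub>f(\<rho>)\<^sup>q\<close> is the \<open>pq\<close>-th power of
  an \<open>L\<^sup>p\<close> norm, convexity of powers gives \<open>\<bar>m\<^sub>f - m\<^sub>g\<bar> \<le> \<delta> m\<^sub>g + B m\<^bsub>f-g\<^esub>\<close> pointwise in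
  \<open>\<rho>\<close>, where \<open>\<delta> > 0\<close> is arbitrary and \<open>B\<close> depends only on \<open>\<delta>\<close>, \<open>p\<close>, \<open>q\<close>
  (lemma \<open>weighted_mass_diff_le\<close>).

  This estimate is used twice. With \<open>f = u\<^sub>j\<close> and \<open>g = v\<close> it turns the local \<open>L\<^sup>p\<close> convergence
  into the pointwise convergence of \<open>m\<close> along \<open>u\<^sub>j\<close> to \<open>m\<^sub>v\<close>, so that Fatou's lemma yields the
  finiteness of the norm of \<open>v\<close>. With \<open>f = u\<^sub>j\<close> and \<open>g = u\<^sub>j - v\<close> it bounds
  \<open>\<bar>m\<^sub>f - m\<^sub>g - m\<^sub>v\<bar> - \<delta> m\<^sub>g\<close> by a multiple of the integrable function \<open>m\<^sub>v\<close>, and dominated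
  convergence applies to its positive part (lemma \<open>brezis_lieb_abstract\<close>). The remaining term
  \<open>\<delta> \<integral> m\<^sub>g\<close> is small because the norms of \<open>u\<^sub>j - v\<close> are bounded.
\<close>

section \<open>Scalar inequalities\<close>

text \<open>The weight \<open>t\<close> is a free parameter: as \<open>t \<rightarrow> 0\<close> the coefficient of \<open>a\<^sup>p\<close> tends to \<open>1\<close>,
  at the price of a large coefficient of \<open>b\<^sup>p\<close> when \<open>p > 1\<close>.\<close>

lemma add_powr_le:
  fixes a b p t :: real
  assumes "1 \<le> p" "0 < t" "t < 1" "0 \<le> a" "0 \<le> b"
  shows "(a + b) powr p \<le> (1 - t) powr (1 - p) * a powr p + t powr (1 - p) * b powr p"
proof -
  have one_le: "1 \<le> s powr (1 - p)" if "0 < s" "s < 1" for s :: real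
    using that assms(1) powr_mono2'[of "1 - p" s 1] by simp
  consider "a = 0" | "b = 0" | "0 < a" "0 < b" using assms by linarith
  then show ?thesis
  proof cases
    case 1
    then show ?thesis
      using mult_right_mono[OF one_le[of t], of "b powr p"] assms by simp
  next
    case 2
    then show ?thesis
      using mult_right_mono[OF one_le[of "1 - t"], of "a powr p"] assms by simp
  next
    case 3
    have scale: "s * (c / s) powr p = s powr (1 - p) * c powr p" if "0 < s" "0 < c" for s c :: real
      using that by (simp add: powr_divide powr_diff)
    \<comment> \<open>Write \<open>a + b\<close> as a convex combination with weights \<open>1 - t\<close> and \<open>t\<close>.\<close>
    have "((1 - t) * (a / (1 - t)) + t * (b / t)) powr p
        \<le> (1 - t) * (a / (1 - t)) powr p + t * (b / t) powr p"
      using convex_onD[OF powr_convex[OF assms(1)], of t "a / (1 - t)" "b / t"] 3 assms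
      by simp
    also have "(1 - t) * (a / (1 - t)) + t * (b / t) = a + b"
      using assms by simp
    finally show ?thesis
      using scale[of "1 - t" a] scale[of t b] 3 assms by simp
  qed
qed

lemma abs_diff_le_of_mutual_bounds:
  fixes x y z A B :: real
  assumes "x \<le> A * y + B * z" "y \<le> A * x + B * z"
    and "1 \<le> A" "0 \<le> B" "0 \<le> y" "0 \<le> z"
  shows "\<bar>x - y\<bar> \<le> A * (A - 1) * y + A * B * z"
proof -
  have "x - y \<le> (A - 1) * y + B * z"
    using assms(1) by (simp add: algebra_simps)
  also have "\<dots> \<le> A * ((A - 1) * y + B * z)"
    using mult_right_mono[of 1 A "(A - 1) * y + B * z"] assms by simp
  finally have upper: "x - y \<le> A * (A - 1) * y + A * B * z"
    by (simp add: algebra_simps)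
  have "y - x \<le> (A - 1) * x + B * z"
    using assms(2) by (simp add: algebra_simps)
  also have "\<dots> \<le> (A - 1) * (A * y + B * z) + B * z"
    using mult_left_mono[OF assms(1), of "A - 1"] assms by simp
  also have "\<dots> = A * (A - 1) * y + A * B * z"
    by (simp add: algebra_simps)
  finally show ?thesis using upper by linarith
qed

section \<open>An abstract Brezis--Lieb lemma\<close>

lemma brezis_lieb_abstract:
  fixes x y :: "nat \<Rightarrow> 'a \<Rightarrow> real" and z :: "'a \<Rightarrow> real"
  assumes x: "\<And>j. integrable M (x j)" and y: "\<And>j. integrable M (y j)" and z: "integrable M z"
    and y_nonneg: "\<And>j t. 0 \<le> y j t" and z_nonneg: "\<And>t. 0 \<le> z t"
    and C: "\<And>j. integral\<^sup>L M (y j) \<le> C"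
    and x_lim: "\<And>t. (\<lambda>j. x j t) \<longlonglongrightarrow> z t" and y_lim: "\<And>t. (\<lambda>j. y j t) \<longlonglongrightarrow> 0"
    and close: "\<And>\<delta>. 0 < \<delta> \<Longrightarrow> \<exists>B. \<forall>j t. \<bar>x j t - y j t\<bar> \<le> \<delta> * y j t + B * z t"
  shows "(\<lambda>j. integral\<^sup>L M (x j) - integral\<^sup>L M (y j)) \<longlonglongrightarrow> integral\<^sup>L M z"
proof (rule tendstoI)
  fix e :: real assume e: "0 < e"
  define \<delta> where "\<delta> = e / (2 * (\<bar>C\<bar> + 1))"
  have \<delta>: "0 < \<delta>" using e by (simp add: \<delta>_def add_nonneg_pos)
  have \<delta>C: "\<delta> * C \<le> e / 2"
  proof -
    have "\<delta> * C \<le> \<delta> * (\<bar>C\<bar> + 1)" using \<delta> by (intro mult_left_mono) auto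
    also have "\<dots> = e / 2" by (simp add: \<delta>_def field_simps)
    finally show ?thesis .
  qed
  obtain B where B: "\<And>j t. \<bar>x j t - y j t\<bar> \<le> \<delta> * y j t + B * z t"
    using close[OF \<delta>] by blast
  \<comment> \<open>Dominated convergence applies to the part of the defect exceeding \<open>\<delta> y\<^sub>j\<close>.\<close>
  define w where "w j t = max 0 (\<bar>x j t - y j t - z t\<bar> - \<delta> * y j t)" for j t
  have w_int: "integrable M (w j)" for j
    unfolding w_def
    by (intro integrable_max integrable_zero Bochner_Integration.integrable_diff
        integrable_abs integrable_mult_right x y z)
  have w_bound: "norm (w j t) \<le> (\<bar>B\<bar> + 1) * z t" for j t
  proof -
    have "B * z t \<le> \<bar>B\<bar> * z t" using z_nonneg[of t] by (intro mult_right_mono) auto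
    then show ?thesis
      using B[of j t] z_nonneg[of t] mult_nonneg_nonneg[of "\<bar>B\<bar>" "z t"]
      unfolding w_def by (simp add: distrib_right)
  qed
  have w_lim: "(\<lambda>j. w j t) \<longlonglongrightarrow> 0" for t
  proof -
    have "(\<lambda>j. max 0 (\<bar>x j t - y j t - z t\<bar> - \<delta> * y j t))
        \<longlonglongrightarrow> max 0 (\<bar>z t - 0 - z t\<bar> - \<delta> * 0)"
      by (intro tendsto_intros x_lim y_lim)
    then show ?thesis by (simp add: w_def)
  qed
  have "(\<lambda>j. integral\<^sup>L M (w j)) \<longlonglongrightarrow> integral\<^sup>L M (\<lambda>_. 0 :: real)"
  proof (rule integral_dominated_convergence)
    show "integrable M (\<lambda>t. (\<bar>B\<bar> + 1) * z t)" using z by simp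
  qed (use w_int w_lim w_bound in auto)
  then have "(\<lambda>j. integral\<^sup>L M (w j)) \<longlonglongrightarrow> 0" by simp
  then have "\<forall>\<^sub>F j in sequentially. integral\<^sup>L M (w j) < e / 2"
    using e by (intro order_tendstoD(2)) auto
  then show "\<forall>\<^sub>F j in sequentially.
      dist (integral\<^sup>L M (x j) - integral\<^sup>L M (y j)) (integral\<^sup>L M z) < e"
  proof eventually_elim
    case (elim j)
    have "dist (integral\<^sup>L M (x j) - integral\<^sup>L M (y j)) (integral\<^sup>L M z)
        = \<bar>integral\<^sup>L M (\<lambda>t. x j t - y j t - z t)\<bar>"
      using x y z by (simp add: dist_real_def)
    also have "\<dots> \<le> integral\<^sup>L M (\<lambda>t. \<bar>x j t - y j t - z t\<bar>)"
      by (rule integral_abs_bound)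
    also have "\<dots> \<le> integral\<^sup>L M (\<lambda>t. w j t + \<delta> * y j t)"
      using x y z w_int by (intro integral_mono) (auto simp: w_def)
    also have "\<dots> = integral\<^sup>L M (w j) + \<delta> * integral\<^sup>L M (y j)"
      using w_int y by simp
    also have "\<dots> \<le> integral\<^sup>L M (w j) + \<delta> * C"
      using C[of j] \<delta> by simp
    also have "\<dots> < e" using elim \<delta>C by linarith
    finally show ?case .
  qed
qed

section \<open>The local mass\<close>

lemma local_mass_le:
  fixes f g k :: "real ^ 'n \<Rightarrow> real"
  assumes "1 \<le> p" "0 < t" "t < 1"
    and [measurable]: "f \<in> borel_measurable lebesgue"
      "g \<in> borel_measurable lebesgue" "k \<in> borel_measurable lebesgue"
    and le: "\<And>y. \<bar>f y\<bar> \<le> \<bar>g y\<bar> + \<bar>k y\<bar>"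
  shows "local_mass p f \<rho> \<le> ennreal ((1 - t) powr (1 - p)) * local_mass p g \<rho>
      + ennreal (t powr (1 - p)) * local_mass p k \<rho>"
proof -
  have [measurable]: "ball 0 \<rho> \<in> sets (lebesgue :: (real ^ 'n) measure)" by simp
  have "ennreal (\<bar>f y\<bar> powr p) \<le> ennreal ((1 - t) powr (1 - p)) * ennreal (\<bar>g y\<bar> powr p)
      + ennreal (t powr (1 - p)) * ennreal (\<bar>k y\<bar> powr p)" for y
  proof -
    have "\<bar>f y\<bar> powr p \<le> (\<bar>g y\<bar> + \<bar>k y\<bar>) powr p"
      using assms(1) le by (intro powr_mono2) auto
    also have "\<dots> \<le> (1 - t) powr (1 - p) * \<bar>g y\<bar> powr p + t powr (1 - p) * \<bar>k y\<bar> powr p"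
      using assms by (intro add_powr_le) auto
    finally show ?thesis
      by (simp add: ennreal_leI flip: ennreal_mult ennreal_plus)
  qed
  then have "local_mass p f \<rho> \<le> (\<integral>\<^sup>+ y.
      ennreal ((1 - t) powr (1 - p)) * (ennreal (\<bar>g y\<bar> powr p) * indicator (ball 0 \<rho>) y)
      + ennreal (t powr (1 - p)) * (ennreal (\<bar>k y\<bar> powr p) * indicator (ball 0 \<rho>) y) \<partial>lebesgue)"
    unfolding local_mass_def by (intro nn_integral_mono) (auto simp: indicator_def)
  also have "\<dots> = ennreal ((1 - t) powr (1 - p)) * local_mass p g \<rho>
      + ennreal (t powr (1 - p)) * local_mass p k \<rho>"
    unfolding local_mass_def by (subst nn_integral_add) (auto simp: nn_integral_cmult)
  finally show ?thesis .
qed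

lemma local_mass_le_cball:
  fixes f :: "real ^ 'n \<Rightarrow> real"
  shows "local_mass p f \<rho> \<le> (\<integral>\<^sup>+ y \<in> cball 0 \<rho>. ennreal (\<bar>f y\<bar> powr p) \<partial>lebesgue)"
  unfolding local_mass_def by (intro nn_integral_mono) (auto simp: indicator_def)

lemma Lp_loc_measurable: "f \<in> Lp_loc p \<Longrightarrow> f \<in> borel_measurable lebesgue"
  by (simp add: Lp_loc_def)

lemma Lp_loc_local_mass_finite: "f \<in> Lp_loc p \<Longrightarrow> local_mass p f \<rho> < \<infinity>"
  using le_less_trans[OF local_mass_le_cball[of p f \<rho>]] by (auto simp: Lp_loc_def)

lemma local_mass_mono:
  fixes f :: "real ^ 'n \<Rightarrow> real"
  assumes "\<rho> \<le> \<sigma>"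
  shows "local_mass p f \<rho> \<le> local_mass p f \<sigma>"
  unfolding local_mass_def
  by (intro nn_integral_mono) (use assms in \<open>auto simp: indicator_def\<close>)

section \<open>The radial density of the norm\<close>

text \<open>The integrand \<open>\<rho>\<^sup>-\<^sup>b h\<^sub>f(\<rho>)\<^sup>q\<close> as a real function on the whole line, extended by zero to
  \<open>\<rho> \<le> 0\<close>. It represents the integrand faithfully when \<open>f\<close> has finite mass on every ball.\<close>

definition weighted_mass ::
    "real \<Rightarrow> real \<Rightarrow> real \<Rightarrow> (real ^ 'n \<Rightarrow> real) \<Rightarrow> real \<Rightarrow> real" where
  "weighted_mass p q b f \<rho> =
     indicator {0<..} \<rho> * \<rho> powr (- b) * enn2real (local_mass p f \<rho>) powr q"

lemma weighted_mass_nonneg: "0 \<le> weighted_mass p q b f \<rho>"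
  by (simp add: weighted_mass_def)

lemma weighted_mass_measurable:
  fixes f :: "real ^ 'n \<Rightarrow> real"
  assumes "\<And>\<rho>. local_mass p f \<rho> < \<infinity>"
  shows "weighted_mass p q b f \<in> borel_measurable lborel"
proof -
  have "mono (\<lambda>\<rho>. enn2real (local_mass p f \<rho>))"
    using assms by (intro monoI enn2real_mono local_mass_mono) auto
  then have [measurable]: "(\<lambda>\<rho>. enn2real (local_mass p f \<rho>)) \<in> borel_measurable borel"
    by (rule borel_measurable_mono)
  show ?thesis unfolding weighted_mass_def by measurable
qed

lemma Lpq_integral_eq:
  fixes f :: "real ^ 'n \<Rightarrow> real"
  assumes "\<And>\<rho>. local_mass p f \<rho> < \<infinity>"
  shows "Lpq_integral p q b f = (\<integral>\<^sup>+ \<rho>. ennreal (weighted_mass p q b f \<rho>) \<partial>lborel)"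
  unfolding Lpq_integral_def
proof (rule nn_integral_cong)
  fix \<rho> :: real
  show "ennreal (\<rho> powr - b) * ennreal_powr (local_mass p f \<rho>) q * indicator {0<..} \<rho>
      = ennreal (weighted_mass p q b f \<rho>)"
    using assms[of \<rho>]
    by (auto simp: weighted_mass_def ennreal_powr_def indicator_def ennreal_mult)
qed

lemma Lpq_norm_powr:
  assumes "0 < p * q"
  shows "Lpq_norm p q b f powr (p * q) = enn2real (Lpq_integral p q b f)"
proof -
  have "p \<noteq> 0" "q \<noteq> 0" using assms by auto
  then show ?thesis by (simp add: Lpq_norm_def powr_powr)
qed

text \<open>Convexity is used twice, with exponent \<open>p\<close> under the integral and with exponent \<open>q\<close>
  outside. With the same \<open>t\<close> both times the constants combine to those of exponent \<open>pq\<close>.\<close>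

lemma weighted_mass_le:
  fixes f g k :: "real ^ 'n \<Rightarrow> real"
  assumes "1 \<le> p" "1 \<le> q" "0 < t" "t < 1"
    and meas: "f \<in> borel_measurable lebesgue" "g \<in> borel_measurable lebesgue"
      "k \<in> borel_measurable lebesgue"
    and le: "\<And>y. \<bar>f y\<bar> \<le> \<bar>g y\<bar> + \<bar>k y\<bar>"
    and fin: "local_mass p g \<rho> < \<infinity>" "local_mass p k \<rho> < \<infinity>"
  shows "weighted_mass p q b f \<rho> \<le> (1 - t) powr (1 - p * q) * weighted_mass p q b g \<rho>
      + t powr (1 - p * q) * weighted_mass p q b k \<rho>"
proof -
  define F G K where "F = enn2real (local_mass p f \<rho>)" and "G = enn2real (local_mass p g \<rho>)"
    and "K = enn2real (local_mass p k \<rho>)"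
  have nonneg: "0 \<le> F" "0 \<le> G" "0 \<le> K" by (simp_all add: F_def G_def K_def)
  have "local_mass p f \<rho> \<le> ennreal ((1 - t) powr (1 - p)) * local_mass p g \<rho>
      + ennreal (t powr (1 - p)) * local_mass p k \<rho>"
    using assms by (intro local_mass_le) auto
  also have "\<dots> = ennreal ((1 - t) powr (1 - p) * G + t powr (1 - p) * K)"
    using fin nonneg by (simp add: G_def K_def ennreal_mult less_top)
  finally have "F \<le> (1 - t) powr (1 - p) * G + t powr (1 - p) * K"
    unfolding F_def using nonneg by (intro enn2real_leI) auto
  then have "F powr q \<le> ((1 - t) powr (1 - p) * G + t powr (1 - p) * K) powr q"
    using nonneg assms by (intro powr_mono2) auto
  also have "\<dots> \<le> (1 - t) powr (1 - q) * ((1 - t) powr (1 - p) * G) powr q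
      + t powr (1 - q) * (t powr (1 - p) * K) powr q"
    using nonneg assms by (intro add_powr_le) auto
  also have "\<dots> = (1 - t) powr (1 - p * q) * G powr q + t powr (1 - p * q) * K powr q"
  proof -
    have "s powr (1 - q) * (s powr (1 - p) * c) powr q = s powr (1 - p * q) * c powr q"
      if "0 < s" "0 \<le> c" for s c :: real
    proof -
      have "(s powr (1 - p) * c) powr q = s powr ((1 - p) * q) * c powr q"
        using that by (simp add: powr_mult powr_powr)
      moreover have "s powr (1 - q) * s powr ((1 - p) * q) = s powr (1 - p * q)"
        by (simp add: algebra_simps flip: powr_add)
      ultimately show ?thesis by (simp flip: mult.assoc)
    qed
    then show ?thesis using nonneg assms by simp
  qed
  finally have *: "F powr q \<le> (1 - t) powr (1 - p * q) * G powr q + t powr (1 - p * q) * K powr q" .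
  have "0 \<le> indicator {0<..} \<rho> * \<rho> powr (- b)" by simp
  from mult_left_mono[OF * this] show ?thesis
    by (simp add: weighted_mass_def F_def G_def K_def algebra_simps)
qed

text \<open>The quantitative heart of the argument: a perturbation of \<open>g\<close> changes the radial density
  by an arbitrarily small fraction of that of \<open>g\<close>, up to a multiple of the radial density of the
  perturbation. The constant \<open>B\<close> does not depend on the functions or on the radius.\<close>

lemma weighted_mass_diff_le:
  assumes pq: "1 \<le> p" "1 \<le> q" and \<delta>: "0 < \<delta>"
  shows "\<exists>B. \<forall>(f :: real ^ 'n \<Rightarrow> real) g \<rho>.
      f \<in> borel_measurable lebesgue \<longrightarrow> g \<in> borel_measurable lebesgue \<longrightarrow>
      local_mass p f \<rho> < \<infinity> \<longrightarrow> local_mass p g \<rho> < \<infinity> \<longrightarrow>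
      local_mass p (\<lambda>y. f y - g y) \<rho> < \<infinity> \<longrightarrow>
      \<bar>weighted_mass p q b f \<rho> - weighted_mass p q b g \<rho>\<bar>
        \<le> \<delta> * weighted_mass p q b g \<rho> + B * weighted_mass p q b (\<lambda>y. f y - g y) \<rho>"
proof -
  define a where "a t = (1 - t) powr (1 - p * q)" for t :: real
  \<comment> \<open>Pick \<open>t\<close> so small that the factor \<open>a (a - 1)\<close> of the mutual bound falls below \<open>\<delta>\<close>.\<close>
  have "(a \<longlongrightarrow> (1 - 0) powr (1 - p * q)) (at_right 0)"
    unfolding a_def by (intro tendsto_intros) auto
  then have a: "(a \<longlongrightarrow> 1) (at_right 0)" by simp
  have "((\<lambda>t. a t * (a t - 1)) \<longlongrightarrow> 1 * (1 - 1)) (at_right 0)"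
    by (intro tendsto_intros a)
  then have "\<forall>\<^sub>F t in at_right 0. a t * (a t - 1) < \<delta>"
    using \<delta> by (intro order_tendstoD(2)) auto
  then have "\<forall>\<^sub>F t in at_right 0. a t * (a t - 1) < \<delta> \<and> 0 < t \<and> t < 1"
    using eventually_at_right_less[of "0::real"] eventually_at_rightI[of 0 1 "\<lambda>t::real. t < 1"]
    by (auto intro!: eventually_conj)
  then obtain t where t: "a t * (a t - 1) < \<delta>" "0 < t" "t < 1"
    using eventually_happens'[OF trivial_limit_at_right_real] by blast
  have "1 \<le> p * q" using mult_mono[of 1 p 1 q] pq by simp
  then have a1: "1 \<le> a t"
    unfolding a_def using t powr_mono2'[of "1 - p * q" "1 - t" 1] by simp
  define c where "c = t powr (1 - p * q)"
  show ?thesis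
  proof (intro exI[of _ "a t * c"] allI impI)
    fix f g :: "real ^ 'n \<Rightarrow> real" and \<rho> :: real
    assume meas [measurable]: "f \<in> borel_measurable lebesgue" "g \<in> borel_measurable lebesgue"
      and fin: "local_mass p f \<rho> < \<infinity>" "local_mass p g \<rho> < \<infinity>"
        "local_mass p (\<lambda>y. f y - g y) \<rho> < \<infinity>"
    let ?m = "\<lambda>f. weighted_mass p q b f \<rho>"
    let ?k = "\<lambda>y. f y - g y"
    have "?m f \<le> a t * ?m g + c * ?m ?k" "?m g \<le> a t * ?m f + c * ?m ?k"
      unfolding a_def c_def using pq t fin by (auto intro!: weighted_mass_le)
    then have "\<bar>?m f - ?m g\<bar> \<le> a t * (a t - 1) * ?m g + a t * c * ?m ?k"
      using a1 by (intro abs_diff_le_of_mutual_bounds) (auto simp: c_def weighted_mass_nonneg)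
    also have "\<dots> \<le> \<delta> * ?m g + a t * c * ?m ?k"
      using mult_right_mono[OF less_imp_le[OF t(1)] weighted_mass_nonneg] by simp
    finally show "\<bar>?m f - ?m g\<bar> \<le> \<delta> * ?m g + a t * c * ?m ?k" .
  qed
qed

section \<open>Convergence of the norms\<close>

theorem theorem2p5:
  fixes p q b :: real
    and u :: "nat \<Rightarrow> real ^ 'n \<Rightarrow> real"
    and v :: "real ^ 'n \<Rightarrow> real"
  assumes "CARD('n) \<ge> 2"
    and "1 < p" and "1 \<le> q" and "1 < b" and "b < 1 + real CARD('n) * q"
    and "\<And>j. u j \<in> Lpq_space p q b"
    and "\<exists>C. \<forall>j. Lpq_norm p q b (u j) \<le> C"
    and "tendsto_Lp_loc p u v"
  shows "v \<in> Lpq_space p q b \<and>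
    (\<lambda>j. Lpq_norm p q b (u j) powr (p * q) - Lpq_norm p q b (\<lambda>x. u j x - v x) powr (p * q))
      \<longlonglongrightarrow> Lpq_norm p q b v powr (p * q)"
proof -
  let ?m = "weighted_mass p q b"
  define k where "k j = (\<lambda>y. u j y - v y)" for j
  have pq: "1 \<le> p" "1 \<le> q" "0 < p" "0 < q" "0 < p * q" using assms by auto
  have loc: "u j \<in> Lp_loc p" "v \<in> Lp_loc p" for j
    using assms(8) by (auto simp: tendsto_Lp_loc_def)
  note meas [measurable] = loc[THEN Lp_loc_measurable]
  have k_meas [measurable]: "k j \<in> borel_measurable lebesgue" for j
    unfolding k_def by measurable
  note fin = loc[THEN Lp_loc_local_mass_finite]
  have k_fin: "local_mass p (k j) \<rho> < \<infinity>" for j \<rho>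
  proof -
    have "local_mass p (k j) \<rho> \<le> ennreal ((1 - 1 / 2) powr (1 - p)) * local_mass p (u j) \<rho>
        + ennreal ((1 / 2) powr (1 - p)) * local_mass p v \<rho>"
      using pq by (intro local_mass_le) (auto simp: k_def)
    also have "\<dots> < \<infinity>"
      using fin(1)[of j \<rho>] fin(2)[of \<rho>] by (simp add: ennreal_mult_less_top)
    finally show ?thesis .
  qed
  note m_meas [measurable] = weighted_mass_measurable[OF fin(1)] weighted_mass_measurable[OF fin(2)]
    weighted_mass_measurable[OF k_fin]
  have density_integrable: "integrable lborel (?m f) \<and>
      Lpq_integral p q b f = ennreal (integral\<^sup>L lborel (?m f))"
    if "?m f \<in> borel_measurable lborel" "\<And>\<rho>. local_mass p f \<rho> < \<infinity>" "Lpq_integral p q b f < \<infinity>"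
    for f :: "real ^ 'n \<Rightarrow> real"
  proof -
    have "integrable lborel (?m f)"
      using that by (intro integrableI_nonneg) (auto simp: Lpq_integral_eq weighted_mass_nonneg)
    then show ?thesis
      using that by (simp add: Lpq_integral_eq nn_integral_eq_integral weighted_mass_nonneg)
  qed

  have close: "\<exists>B. \<forall>j \<rho>. \<bar>?m (f j) \<rho> - ?m (g j) \<rho>\<bar>
      \<le> \<delta> * ?m (g j) \<rho> + B * ?m (\<lambda>y. f j y - g j y) \<rho>"
    if "0 < \<delta>" "\<And>j. f j \<in> borel_measurable lebesgue" "\<And>j. g j \<in> borel_measurable lebesgue"
      "\<And>j \<rho>. local_mass p (f j) \<rho> < \<infinity>" "\<And>j \<rho>. local_mass p (g j) \<rho> < \<infinity>"
      "\<And>j \<rho>. local_mass p (\<lambda>y. f j y - g j y) \<rho> < \<infinity>"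
    for \<delta> and f g :: "nat \<Rightarrow> real ^ 'n \<Rightarrow> real"
    using weighted_mass_diff_le[OF pq(1,2) that(1), where b = b and 'n = 'n] that(2-) by blast

  have k_lim: "(\<lambda>j. ?m (k j) \<rho>) \<longlonglongrightarrow> 0" for \<rho>
  proof -
    have "(\<lambda>j. local_mass p (k j) \<rho>) \<longlonglongrightarrow> 0"
    proof (rule tendsto_sandwich[OF _ _ tendsto_const])
      show "\<forall>\<^sub>F j in sequentially. local_mass p (k j) \<rho>
          \<le> (\<integral>\<^sup>+ y \<in> cball 0 \<rho>. ennreal (\<bar>u j y - v y\<bar> powr p) \<partial>lebesgue)"
        unfolding k_def by (intro always_eventually allI local_mass_le_cball)
      show "(\<lambda>j. \<integral>\<^sup>+ y \<in> cball 0 \<rho>. ennreal (\<bar>u j y - v y\<bar> powr p) \<partial>lebesgue) \<longlonglongrightarrow> 0"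
        using assms(8) by (simp add: tendsto_Lp_loc_def)
    qed auto
    then have "(\<lambda>j. enn2real (local_mass p (k j) \<rho>)) \<longlonglongrightarrow> enn2real 0"
      by (intro tendsto_enn2real) auto
    then have "(\<lambda>j. enn2real (local_mass p (k j) \<rho>) powr q) \<longlonglongrightarrow> 0"
      using pq by (auto intro: tendsto_zero_powrI[where b = q])
    then show ?thesis
      unfolding weighted_mass_def by (rule tendsto_mult_right_zero)
  qed

  have u_lim: "(\<lambda>j. ?m (u j) \<rho>) \<longlonglongrightarrow> ?m v \<rho>" for \<rho>
  proof (rule tendstoI)
    fix e :: real assume e: "0 < e"
    define \<delta> where "\<delta> = e / (2 * (?m v \<rho> + 1))"
    have pos: "0 < ?m v \<rho> + 1" by (simp add: add_nonneg_pos weighted_mass_nonneg)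
    then have \<delta>: "0 < \<delta>" using e by (simp add: \<delta>_def)
    have "\<delta> * ?m v \<rho> \<le> \<delta> * (?m v \<rho> + 1)" using \<delta> by simp
    also have "\<dots> = e / 2" using pos by (simp add: \<delta>_def field_simps)
    finally have \<delta>v: "\<delta> * ?m v \<rho> \<le> e / 2" .
    obtain B where B: "\<bar>?m (u j) \<rho> - ?m v \<rho>\<bar> \<le> \<delta> * ?m v \<rho> + B * ?m (k j) \<rho>" for j
      using close[OF \<delta>, of u "\<lambda>_. v"] meas fin k_fin unfolding k_def by blast
    have "\<forall>\<^sub>F j in sequentially. B * ?m (k j) \<rho> < e / 2"
      using e by (intro order_tendstoD(2)[OF tendsto_mult_right_zero[OF k_lim]]) auto
    then show "\<forall>\<^sub>F j in sequentially. dist (?m (u j) \<rho>) (?m v \<rho>) < e"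
    proof eventually_elim
      case (elim j)
      then show ?case using B[of j] \<delta>v by (simp add: dist_real_def)
    qed
  qed

  obtain C where C: "\<And>j. Lpq_norm p q b (u j) \<le> C" using assms(7) by blast
  define D where "D = \<bar>C\<bar> powr (p * q)"
  have u_int_fin: "Lpq_integral p q b (u j) < \<infinity>" for j
    using assms(6)[of j] by (simp add: Lpq_space_def)
  have u_le: "Lpq_integral p q b (u j) \<le> ennreal D" for j
  proof -
    have "Lpq_norm p q b (u j) powr (p * q) \<le> D"
      unfolding D_def using pq C[of j] by (intro powr_mono2) (auto simp: Lpq_norm_def)
    then have "enn2real (Lpq_integral p q b (u j)) \<le> D"
      using pq by (simp add: Lpq_norm_powr)
    then have "ennreal (enn2real (Lpq_integral p q b (u j))) \<le> ennreal D"
      by (rule ennreal_leI)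
    then show ?thesis using u_int_fin[of j] by (simp add: less_top)
  qed

  have v_le: "Lpq_integral p q b v \<le> ennreal D"
  proof -
    have "liminf (\<lambda>j. ennreal (?m (u j) \<rho>)) = ennreal (?m v \<rho>)" for \<rho>
      by (intro lim_imp_Liminf tendsto_ennrealI u_lim) auto
    then have "Lpq_integral p q b v = (\<integral>\<^sup>+ \<rho>. liminf (\<lambda>j. ennreal (?m (u j) \<rho>)) \<partial>lborel)"
      by (simp add: Lpq_integral_eq[OF fin(2)])
    also have "\<dots> \<le> liminf (\<lambda>j. \<integral>\<^sup>+ \<rho>. ennreal (?m (u j) \<rho>) \<partial>lborel)"
      by (intro nn_integral_liminf) measurable
    also have "\<dots> = liminf (\<lambda>j. Lpq_integral p q b (u j))"
      by (simp add: Lpq_integral_eq[OF fin(1)])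
    also have "\<dots> \<le> limsup (\<lambda>j. Lpq_integral p q b (u j))"
      by (intro Liminf_le_Limsup) auto
    also have "\<dots> \<le> ennreal D"
      by (intro Limsup_bounded) (simp add: u_le)
    finally show ?thesis .
  qed
  then have v_int_fin: "Lpq_integral p q b v < \<infinity>" by (auto intro: le_less_trans)

  note u_int = density_integrable[OF m_meas(1) fin(1) u_int_fin]
  note v_int = density_integrable[OF m_meas(2) fin(2) v_int_fin]
  have int_nonneg: "0 \<le> integral\<^sup>L lborel (?m f)" for f :: "real ^ 'n \<Rightarrow> real"
    by (simp add: weighted_mass_nonneg)
  have int_le: "integral\<^sup>L lborel (?m (u j)) \<le> D" "integral\<^sup>L lborel (?m v) \<le> D" for j
    using u_le[of j] v_le u_int[of j] v_int by (simp_all add: D_def)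

  \<comment> \<open>Any fixed \<open>t\<close> serves to bound the norms of \<open>u\<^sub>j - v\<close>; here \<open>t = 1/2\<close>.\<close>
  define S where "S = (1 / 2 :: real) powr (1 - p * q)"
  have k_le: "?m (k j) \<rho> \<le> S * ?m (u j) \<rho> + S * ?m v \<rho>" for j \<rho>
    using weighted_mass_le[of p q "1 / 2" "k j" "u j" v \<rho> b] pq meas k_meas fin
    by (simp add: S_def k_def)
  have k_integrable: "integrable lborel (?m (k j))" for j
  proof (rule Bochner_Integration.integrable_bound)
    show "integrable lborel (\<lambda>\<rho>. S * ?m (u j) \<rho> + S * ?m v \<rho>)"
      using u_int v_int by simp
    show "AE \<rho> in lborel. norm (?m (k j) \<rho>) \<le> norm (S * ?m (u j) \<rho> + S * ?m v \<rho>)"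
      using order_trans[OF k_le[of j] abs_ge_self] weighted_mass_nonneg[of p q b "k j"]
      by (intro AE_I2) simp
  qed measurable
  have k_eq: "Lpq_integral p q b (k j) = ennreal (integral\<^sup>L lborel (?m (k j)))" for j
    using k_integrable[of j]
    by (simp add: Lpq_integral_eq[OF k_fin] nn_integral_eq_integral weighted_mass_nonneg)
  have k_int_le: "integral\<^sup>L lborel (?m (k j)) \<le> S * D + S * D" for j
  proof -
    have "integral\<^sup>L lborel (?m (k j)) \<le> integral\<^sup>L lborel (\<lambda>\<rho>. S * ?m (u j) \<rho> + S * ?m v \<rho>)"
      using k_integrable u_int v_int k_le by (intro integral_mono) auto
    also have "\<dots> = S * integral\<^sup>L lborel (?m (u j)) + S * integral\<^sup>L lborel (?m v)"
      using u_int v_int by simp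
    also have "\<dots> \<le> S * D + S * D"
      using int_le by (intro add_mono mult_left_mono) (auto simp: S_def)
    finally show ?thesis .
  qed

  have "(\<lambda>j. integral\<^sup>L lborel (?m (u j)) - integral\<^sup>L lborel (?m (k j)))
      \<longlonglongrightarrow> integral\<^sup>L lborel (?m v)"
  proof (rule brezis_lieb_abstract[where C = "S * D + S * D"])
    fix \<delta> :: real assume \<delta>: "0 < \<delta>"
    have diff: "(\<lambda>y. u j y - k j y) = v" for j by (simp add: k_def)
    show "\<exists>B. \<forall>j \<rho>. \<bar>?m (u j) \<rho> - ?m (k j) \<rho>\<bar> \<le> \<delta> * ?m (k j) \<rho> + B * ?m v \<rho>"
      using close[OF \<delta>, of u k, unfolded diff] meas k_meas fin k_fin by blast
  next
    show "integrable lborel (?m (u j))" for j using u_int by blast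
  next
    show "integrable lborel (?m v)" using v_int by blast
  qed (fact k_integrable k_int_le u_lim k_lim weighted_mass_nonneg)+
  then have "(\<lambda>j. Lpq_norm p q b (u j) powr (p * q) - Lpq_norm p q b (k j) powr (p * q))
      \<longlonglongrightarrow> Lpq_norm p q b v powr (p * q)"
    using u_int v_int k_eq pq int_nonneg by (simp add: Lpq_norm_powr)
  then show ?thesis
    using v_int_fin meas by (simp add: Lpq_space_def k_def)
qed

end
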